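(* For every positive integer $n\ne4$, the symmetric group $\Sigma_n$ admits no non-abelian representation over $\mathbb C$ of dimension $d<n-1$; that is, every homomorphism $\Sigma_n\to\mathrm{GL}_d(\mathbb C)$ with $d<n-1$ has abelian image. *)

theory Defs
  imports "HOL-Algebra.Sym_Groups" "Jordan_Normal_Form.Matrix"
begin

(* Matrices with carrier rather than type-indexed ones, so that the dimension d is an
   ordinary natural number; d = 0 is allowed and gives the trivial group. *)
definition GL :: "nat \<Rightarrow> complex mat monoid"
  where "GL d = units_of (ring_mat TYPE(complex) d ())"

lemma GL_is_group: "group (GL d)"
proof -
  interpret ring "ring_mat TYPE(complex) d ()" by (rule ring_mat)
  show ?thesis unfolding GL_def by (rule units_group)
qed

lemma carrier_GL:
  "carrier (GL d) = {A \<in> carrier_mat d d. \<exists>B \<in> carrier_mat d d. B * A = 1\<^sub>m d \<and> A * B = 1\<^sub>m d}"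
  by (auto simp: GL_def units_of_def Units_def ring_mat_simps)

lemma mult_GL: "A \<otimes>\<^bsub>GL d\<^esub> B = A * B"
  by (simp add: GL_def units_of_def ring_mat_simps)

end

theory Submission
  imports Defs "HOL-Library.Function_Algebras"
begin

text \<open>
  The heart of the matter is a lower bound: if an action of the symmetric group on a set \<open>S\<close> of
  at least four letters gives two disjoint transpositions different images, then the space it acts
  on contains \<open>card S - 1\<close> independent vectors (lemma \<open>separated_imp_independent\<close>). The proof
  descends from \<open>S\<close> to \<open>S - {p, q}\<close>. The image of the transposition \<open>(p q)\<close> is an involution, and
  its two eigenspaces are stable under all transpositions of \<open>S - {p, q}\<close>.

  If both eigenspaces have dimension at least two, then the disjoint transpositions are still
  told apart on one of them, which by induction contains \<open>card S - 3\<close> independent vectors, and the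
  other eigenspace supplies two more. For four or five letters the vectors from the two
  eigenspaces, two plus two, are already enough, so the induction has no exceptional base case.

  If the eigenspace for \<open>-1\<close> is at most a line, every transposition acts as a reflection (the
  eigenspace for \<open>1\<close> is treated by changing the sign of all transpositions). After choosing a letter
  \<open>o\<close>, the roots \<open>w\<^sub>b\<close> of the reflections \<open>(o b)\<close> can be scaled so that the other letters permute
  them. The braid relations then force \<open>(o a) w\<^sub>b = w\<^sub>b - w\<^sub>a\<close>, as for the roots
  \<open>e\<^sub>o - e\<^sub>b\<close> of the standard reflection representation, and these formulas make the
  \<open>card S - 1\<close> roots independent (lemma \<open>independent_roots\<close>).

  Consequently, in dimension \<open>d < n - 1\<close> disjoint transpositions have the same image. When
  \<open>n \<ge> 5\<close>, any two transpositions have equal images: if they share a letter, both are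
  disjoint from a third one. So the image has at most two elements. For four letters, two
  overlapping transpositions have no common disjoint partner; indeed the symmetric group on four
  letters maps onto that on three, which has a non-abelian representation of dimension two. For
  \<open>n \<le> 3\<close> the matrices have size at most one and commute.
\<close>

section \<open>Tuples of letters and independent sets\<close>

text \<open>A property of tuples of distinct letters that is stable under all transpositions is shared by all
  such tuples or by none: a given tuple is turned into any other by correcting its entries one after
  the other. It carries facts about one pair or quadruple of letters to all others.\<close>
lemma transport_distinct_list:
  assumes step: "\<And>a b zs. \<lbrakk>a \<in> S; b \<in> S; a \<noteq> b; distinct zs; set zs \<subseteq> S;
      length zs = length ys; P zs\<rbrakk>
      \<Longrightarrow> P (map (Transposition.transpose a b) zs)"
    and xs: "P xs" "distinct xs" "set xs \<subseteq> S"
    and ys: "distinct ys" "set ys \<subseteq> S"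
    and len: "length xs = length ys"
  shows "P ys"
proof -
  have "\<exists>zs. P zs \<and> distinct zs \<and> set zs \<subseteq> S \<and> length zs = length ys \<and> (\<forall>i<k. zs ! i = ys ! i)"
    if "k \<le> length ys" for k
    using that
  proof (induction k)
    case 0
    show ?case using xs len by auto
  next
    case (Suc k)
    then obtain zs where zs: "P zs" "distinct zs" "set zs \<subseteq> S" "length zs = length ys"
      and agree: "\<And>i. i < k \<Longrightarrow> zs ! i = ys ! i"
      by auto
    show ?case
    proof (cases "zs ! k = ys ! k")
      case True
      then show ?thesis using zs agree less_Suc_eq by auto
    next
      case False
      let ?t = "Transposition.transpose (zs ! k) (ys ! k)"
      have mem: "zs ! k \<in> S" "ys ! k \<in> S"
        using zs ys Suc.prems by (auto simp: subset_iff)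
      have "P (map ?t zs)"
        using step mem False zs by blast
      moreover have "distinct (map ?t zs)"
        using zs inj_transpose by (auto simp: distinct_map intro: inj_on_subset)
      moreover have "set (map ?t zs) \<subseteq> S"
        using zs mem by (auto simp: Transposition.transpose_def)
      moreover have "map ?t zs ! i = ys ! i" if "i < Suc k" for i
      proof (cases "i = k")
        case True
        then show ?thesis using zs Suc.prems by simp
      next
        case False
        then have "i < k" using that by simp
        then have "zs ! i \<noteq> zs ! k" "ys ! i \<noteq> ys ! k"
          using zs ys Suc.prems by (auto simp: nth_eq_iff_index_eq)
        then show ?thesis using agree[OF \<open>i < k\<close>] \<open>i < k\<close> zs Suc.prems by simp
      qed
      ultimately show ?thesis using zs by (intro exI[of _ "map ?t zs"]) auto
    qed
  qed
  then obtain zs where "P zs" "length zs = length ys" "\<forall>i<length ys. zs ! i = ys ! i"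
    by blast
  then show ?thesis by (metis nth_equalityI)
qed

lemma ex_outside:
  assumes "length xs < card S"
  obtains x where "x \<in> S" "x \<notin> set xs"
proof -
  have "\<not> S \<subseteq> set xs"
    using assms card_mono[of "set xs" S] card_length[of xs] by auto
  then show ?thesis using that by blast
qed

lemma (in vector_space) independent_Un_if_trivial_Int:
  assumes "subspace U" "subspace V" "U \<inter> V \<subseteq> {0}"
    and "A \<subseteq> U" "B \<subseteq> V" "independent A" "independent B" "finite B"
  shows "independent (A \<union> B) \<and> A \<inter> B = {}"
proof
  show "independent (A \<union> B)"
    using \<open>finite B\<close> \<open>B \<subseteq> V\<close> \<open>independent B\<close>
  proof (induction B rule: finite_induct)
    case empty
    then show ?case using assms by simp
  next
    case (insert x B)
    have indB: "independent B" "x \<notin> span B"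
      using insert by (auto simp: independent_insert)
    have "x \<notin> span (A \<union> B)"
    proof
      assume "x \<in> span (A \<union> B)"
      then obtain y z where yz: "x = y + z" "y \<in> span A" "z \<in> span B"
        by (auto simp: span_Un)
      have "y \<in> U" using yz span_minimal[OF \<open>A \<subseteq> U\<close> \<open>subspace U\<close>] by auto
      moreover have "y \<in> V"
      proof -
        have "z \<in> V" using yz span_minimal[OF _ \<open>subspace V\<close>, of B] insert by auto
        then have "x - z \<in> V" using insert subspace_diff[OF \<open>subspace V\<close>] by auto
        then show ?thesis using yz by simp
      qed
      ultimately have "y = 0" using assms by auto
      then show False using yz indB by simp
    qed
    then show ?case using insert indB by (simp add: independent_insert)
  qed
  show "A \<inter> B = {}"
    using assms dependent_zero by blast
qed

text \<open>The zero space counts as a line here, with the generator zero.\<close>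
lemma (in vector_space) line_or_independent_pair:
  assumes "subspace E"
  shows "(\<exists>v\<in>E. E \<subseteq> span {v}) \<or> (\<exists>B\<subseteq>E. finite B \<and> independent B \<and> card B = 2)"
proof (rule disjCI)
  assume "\<not> (\<exists>B\<subseteq>E. finite B \<and> independent B \<and> card B = 2)"
  then have no_pair: "u \<in> span {v}" if "u \<in> E" "v \<in> E" "v \<noteq> 0" for u v
  proof -
    have "\<not> (u \<notin> span {v} \<and> u \<noteq> v)"
    proof
      assume u: "u \<notin> span {v} \<and> u \<noteq> v"
      then have "independent {u, v}" using that by (simp add: independent_insert)
      moreover have "{u, v} \<subseteq> E" "finite {u, v}" "card {u, v} = 2" using that u by auto
      ultimately show False
        using \<open>\<not> (\<exists>B\<subseteq>E. finite B \<and> independent B \<and> card B = 2)\<close> by blast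
    qed
    then show ?thesis using span_base[of v "{v}"] by auto
  qed
  show "\<exists>v\<in>E. E \<subseteq> span {v}"
  proof (cases "E \<subseteq> {0}")
    case True
    then show ?thesis using subspace_0[OF assms] by (intro bexI[of _ 0]) auto
  next
    case False
    then show ?thesis using no_pair by blast
  qed
qed

section \<open>Operators satisfying the relations of transpositions\<close>

text \<open>An action of a symmetric group is recorded only through the operators of the transpositions,
  because this form is inherited by fewer letters and by smaller subspaces. The operators are linear
  on the whole type, whereas the relations of the symmetric group are required only on the subspace
  \<open>W\<close>. The symmetry of \<open>T\<close> in its two letters is the case \<open>c = a\<close>, \<open>d = b\<close> of the conjugation
  relation.\<close>
locale transposition_action = vector_space scale
  for scale :: "'k::field_char_0 \<Rightarrow> 'v::ab_group_add \<Rightarrow> 'v" (infixr "*s" 75) +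
  fixes S :: "'l set" and W :: "'v set" and T :: "'l \<Rightarrow> 'l \<Rightarrow> 'v \<Rightarrow> 'v"
  assumes subspace_W: "subspace W"
    and T_hom: "\<lbrakk>a \<in> S; b \<in> S; a \<noteq> b\<rbrakk> \<Longrightarrow> module_hom scale scale (T a b)"
    and T_closed: "\<lbrakk>a \<in> S; b \<in> S; a \<noteq> b; x \<in> W\<rbrakk> \<Longrightarrow> T a b x \<in> W"
    and T_invol: "\<lbrakk>a \<in> S; b \<in> S; a \<noteq> b; x \<in> W\<rbrakk> \<Longrightarrow> T a b (T a b x) = x"
    and T_conj: "\<lbrakk>a \<in> S; b \<in> S; a \<noteq> b; c \<in> S; d \<in> S; c \<noteq> d; x \<in> W\<rbrakk> \<Longrightarrow>
      T a b (T c d (T a b x)) = T (Transposition.transpose a b c) (Transposition.transpose a b d) x"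
begin

lemma T_add: "\<lbrakk>a \<in> S; b \<in> S; a \<noteq> b\<rbrakk> \<Longrightarrow> T a b (x + y) = T a b x + T a b y"
  and T_diff: "\<lbrakk>a \<in> S; b \<in> S; a \<noteq> b\<rbrakk> \<Longrightarrow> T a b (x - y) = T a b x - T a b y"
  and T_neg: "\<lbrakk>a \<in> S; b \<in> S; a \<noteq> b\<rbrakk> \<Longrightarrow> T a b (- x) = - T a b x"
  and T_zero: "\<lbrakk>a \<in> S; b \<in> S; a \<noteq> b\<rbrakk> \<Longrightarrow> T a b 0 = 0"
  and T_scale: "\<lbrakk>a \<in> S; b \<in> S; a \<noteq> b\<rbrakk> \<Longrightarrow> T a b (r *s x) = r *s T a b x"
  and T_sum: "\<lbrakk>a \<in> S; b \<in> S; a \<noteq> b\<rbrakk> \<Longrightarrow> T a b (sum f I) = (\<Sum>i\<in>I. T a b (f i))"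
  using T_hom module_hom.add module_hom.diff module_hom.neg module_hom.zero
    module_hom.scale module_hom.sum by metis+

lemma T_commute: "\<lbrakk>a \<in> S; b \<in> S; a \<noteq> b; x \<in> W\<rbrakk> \<Longrightarrow> T a b x = T b a x"
  using T_conj[of a b a b x] T_invol T_closed by simp

lemma T_swap:
  assumes "a \<in> S" "b \<in> S" "a \<noteq> b" "c \<in> S" "d \<in> S" "c \<noteq> d" "x \<in> W"
  shows "T a b (T c d x) = T (Transposition.transpose a b c) (Transposition.transpose a b d) (T a b x)"
  using T_conj[OF assms(1-6), of "T a b x"] assms by (simp add: T_closed T_invol)

lemma transposition_action_Int:
  assumes "S' \<subseteq> S" "subspace W'" "W' \<subseteq> W"
    and "\<And>a b x. \<lbrakk>a \<in> S'; b \<in> S'; a \<noteq> b; x \<in> W'\<rbrakk> \<Longrightarrow> T a b x \<in> W'"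
  shows "transposition_action scale S' W' T"
  using assms T_hom T_invol T_conj vector_space_axioms
  by (intro transposition_action.intro transposition_action_axioms.intro) (auto simp: subset_iff)

text \<open>Tensoring with the sign character; the conjugation relation survives since it has an odd number
  of factors on each side.\<close>
lemma transposition_action_sign_twist: "transposition_action scale S W (\<lambda>a b x. - T a b x)"
proof (intro transposition_action.intro transposition_action_axioms.intro)
  fix a b assume "a \<in> S" "b \<in> S" "a \<noteq> b"
  then interpret module_hom scale scale "T a b" by (rule T_hom)
  show "module_hom scale scale (\<lambda>x. - T a b x)"
    by unfold_locales (simp_all add: add scale)
qed (auto simp: vector_space_axioms subspace_W subspace_neg[OF subspace_W] T_closed T_neg T_invol T_conj)

definition eig :: "'k \<Rightarrow> 'l \<Rightarrow> 'l \<Rightarrow> 'v set"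
  where "eig r a b = {x \<in> W. T a b x = r *s x}"

lemma eig_subset: "eig r a b \<subseteq> W"
  by (auto simp: eig_def)

lemma subspace_eig:
  assumes "a \<in> S" "b \<in> S" "a \<noteq> b"
  shows "subspace (eig r a b)"
  using assms subspace_W
  by (auto simp: subspace_def eig_def T_add T_scale T_zero scale_right_distrib)

lemma eig_transport:
  assumes "a \<in> S" "b \<in> S" "a \<noteq> b" "c \<in> S" "d \<in> S" "c \<noteq> d" "x \<in> eig r c d"
  shows "T a b x \<in> eig r (Transposition.transpose a b c) (Transposition.transpose a b d)"
  using assms T_swap[OF assms(1-6), of x] by (auto simp: eig_def T_closed T_scale)

lemma eig_invariant:
  assumes "distinct [a, b, c, d]" "{a, b, c, d} \<subseteq> S" "x \<in> eig r c d"
  shows "T a b x \<in> eig r c d"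
  using assms eig_transport[of a b c d x r] by auto

lemma eig_minus_one_diff:
  assumes "a \<in> S" "b \<in> S" "a \<noteq> b" "x \<in> W"
  shows "T a b x - x \<in> eig (-1) a b"
  using assms subspace_diff[OF subspace_W] by (auto simp: eig_def T_closed T_diff T_invol)

lemma two_scale: "x + x = 2 *s x"
  by (metis one_add_one scale_left_distrib scale_one)

lemma add_self_eq_0: "(x :: 'v) + x = 0 \<longleftrightarrow> x = 0"
  by (simp add: two_scale)

lemma eig_decompose:
  assumes "a \<in> S" "b \<in> S" "a \<noteq> b" "x \<in> W"
  obtains y z where "y \<in> eig 1 a b" "z \<in> eig (-1) a b" "x = y + z"
proof
  let ?y = "inverse 2 *s (x + T a b x)" and ?z = "inverse 2 *s (x - T a b x)"
  show "?y \<in> eig 1 a b"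
    using assms subspace_W
    by (auto simp: eig_def T_closed T_scale T_add T_invol subspace_add subspace_scale add.commute)
  show "?z \<in> eig (-1) a b"
    using assms subspace_W
    by (auto simp: eig_def T_closed T_scale T_diff T_invol subspace_diff subspace_scale
        simp flip: scale_minus_right)
  have "?y + ?z = inverse 2 *s (x + x)"
    by (simp flip: scale_right_distrib)
  then show "x = ?y + ?z" by (simp add: two_scale)
qed

lemma eig_Int: "eig 1 a b \<inter> eig (-1) a b \<subseteq> {0}"
proof
  fix x assume "x \<in> eig 1 a b \<inter> eig (-1) a b"
  then have "x = - x" by (auto simp: eig_def)
  then have "x + x = 0" by (metis add.left_inverse)
  then show "x \<in> {0}" by (simp add: add_self_eq_0)
qed

text \<open>For distinct letters this means that the double transposition \<open>(a b)(c d)\<close> acts non-trivially on \<open>W\<close>.\<close>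
definition separates :: "'l \<Rightarrow> 'l \<Rightarrow> 'l \<Rightarrow> 'l \<Rightarrow> bool"
  where "separates a b c d \<longleftrightarrow> (\<exists>x\<in>W. T a b x \<noteq> T c d x)"

text \<open>All double transpositions are conjugate.\<close>
lemma separates_all:
  assumes "distinct [a, b, c, d]" "{a, b, c, d} \<subseteq> S" "separates a b c d"
    and "distinct [a', b', c', d']" "{a', b', c', d'} \<subseteq> S"
  shows "separates a' b' c' d'"
proof -
  let ?P = "\<lambda>xs. separates (xs ! 0) (xs ! 1) (xs ! 2) (xs ! 3)"
  have "?P [a', b', c', d']"
  proof (rule transport_distinct_list[of S "[a', b', c', d']" ?P "[a, b, c, d]"])
    fix p q :: 'l and zs :: "'l list"
    assume pq: "p \<in> S" "q \<in> S" "p \<noteq> q"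
      and zs: "distinct zs" "set zs \<subseteq> S" "length zs = length [a', b', c', d']" "?P zs"
    let ?t = "Transposition.transpose p q"
    have mem: "zs ! 0 \<in> S" "zs ! 1 \<in> S" "zs ! 2 \<in> S" "zs ! 3 \<in> S"
      using zs by (auto simp: subset_iff)
    have neq: "zs ! 0 \<noteq> zs ! 1" "zs ! 2 \<noteq> zs ! 3"
      using zs by (auto simp: nth_eq_iff_index_eq)
    obtain x where x: "x \<in> W" "T (zs ! 0) (zs ! 1) x \<noteq> T (zs ! 2) (zs ! 3) x"
      using zs by (auto simp: separates_def)
    have "T p q (T (zs ! 0) (zs ! 1) x) \<noteq> T p q (T (zs ! 2) (zs ! 3) x)"
      using x pq mem neq by (metis T_closed T_invol)
    then have "T (?t (zs ! 0)) (?t (zs ! 1)) (T p q x) \<noteq> T (?t (zs ! 2)) (?t (zs ! 3)) (T p q x)"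
      using T_swap pq mem neq x by metis
    then show "?P (map ?t zs)"
      using zs T_closed[OF pq x(1)] by (auto simp: separates_def)
  qed (use assms in auto)
  then show ?thesis by simp
qed

text \<open>All transpositions are conjugate, so their eigenspaces have the same dimension.\<close>
lemma eig_line_all:
  assumes "p \<in> S" "q \<in> S" "p \<noteq> q" "v \<in> eig r p q" "eig r p q \<subseteq> span {v}"
    and "a \<in> S" "b \<in> S" "a \<noteq> b"
  obtains u where "u \<in> eig r a b" "eig r a b \<subseteq> span {u}" "u = 0 \<longleftrightarrow> v = 0"
proof -
  let ?P = "\<lambda>xs. \<exists>u \<in> eig r (xs ! 0) (xs ! 1). eig r (xs ! 0) (xs ! 1) \<subseteq> span {u} \<and> (u = 0 \<longleftrightarrow> v = 0)"
  have "?P [a, b]"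
  proof (rule transport_distinct_list[of S "[a, b]" ?P "[p, q]"])
    fix c d :: 'l and zs :: "'l list"
    assume cd: "c \<in> S" "d \<in> S" "c \<noteq> d"
      and zs: "distinct zs" "set zs \<subseteq> S" "length zs = length [a, b]" "?P zs"
    let ?t = "Transposition.transpose c d"
    have mem: "zs ! 0 \<in> S" "zs ! 1 \<in> S"
      using zs by (auto simp: subset_iff)
    have neq: "zs ! 0 \<noteq> zs ! 1"
      using zs by (auto simp: nth_eq_iff_index_eq)
    have tmem: "?t (zs ! 0) \<in> S" "?t (zs ! 1) \<in> S"
      using cd mem by (auto simp: Transposition.transpose_def)
    have tneq: "?t (zs ! 0) \<noteq> ?t (zs ! 1)"
      using neq by (metis transpose_involutory)
    obtain u where u: "u \<in> eig r (zs ! 0) (zs ! 1)" "eig r (zs ! 0) (zs ! 1) \<subseteq> span {u}" "u = 0 \<longleftrightarrow> v = 0"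
      using zs by blast
    have "T c d u = 0 \<longleftrightarrow> u = 0"
      using T_invol[OF cd, of u] T_zero[OF cd] u(1) by (auto simp: eig_def)
    have "x \<in> span {T c d u}" if x: "x \<in> eig r (?t (zs ! 0)) (?t (zs ! 1))" for x
    proof -
      have "T c d x \<in> eig r (zs ! 0) (zs ! 1)"
        using eig_transport[OF cd tmem tneq x] by simp
      then obtain k where "T c d x = k *s u" using u by (auto simp: span_singleton)
      then have "x = k *s T c d u"
        using T_invol[OF cd, of x] x by (simp add: eig_def T_scale[OF cd, symmetric])
      then show ?thesis unfolding span_singleton by blast
    qed
    then show "?P (map ?t zs)"
      using zs u(3) eig_transport[OF cd mem neq u(1)] \<open>T c d u = 0 \<longleftrightarrow> u = 0\<close>
      by (auto intro!: bexI[of _ "T c d u"])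
  qed (use assms in auto)
  then show ?thesis using that by auto
qed

text \<open>Otherwise all transpositions would act as the identity.\<close>
lemma separates_imp_eig_nonzero:
  assumes "separates a b c d" "distinct [a, b, c, d]" "{a, b, c, d} \<subseteq> S"
    and "p \<in> S" "q \<in> S" "p \<noteq> q"
  obtains v where "v \<in> eig (-1) p q" "v \<noteq> 0"
proof (rule ccontr)
  assume "\<not> thesis"
  then have sub: "eig (-1) p q \<subseteq> span {0}" using that by auto
  have "0 \<in> eig (-1) p q" using subspace_eig assms subspace_0 by blast
  then have zero: "eig (-1) e f \<subseteq> {0}" if "e \<in> S" "f \<in> S" "e \<noteq> f" for e f
    using eig_line_all[OF assms(4-6) _ sub that] by (metis span_empty span_insert_0)
  have "T e f x = x" if "e \<in> S" "f \<in> S" "e \<noteq> f" "x \<in> W" for e f x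
    using zero[OF that(1-3)] eig_minus_one_diff[OF that] by auto
  then show False using assms by (auto simp: separates_def)
qed

end

section \<open>Transpositions acting as reflections\<close>

text \<open>The second assumption bounds the dimension of the \<open>-1\<close>-eigenspaces by one; that they are non-zero
  follows from the first one when there are four letters.\<close>
locale reflection_action = transposition_action +
  assumes separated: "distinct [a, b, c, d] \<Longrightarrow> {a, b, c, d} \<subseteq> S \<Longrightarrow> separates a b c d"
    and eig_line: "\<lbrakk>a \<in> S; b \<in> S; a \<noteq> b\<rbrakk> \<Longrightarrow> \<exists>v \<in> eig (-1) a b. eig (-1) a b \<subseteq> span {v}"
begin

lemma eig_subset_span:
  assumes "a \<in> S" "b \<in> S" "a \<noteq> b" "u \<in> eig (-1) a b" "u \<noteq> 0" "x \<in> eig (-1) a b"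
  obtains k where "x = k *s u"
proof -
  obtain v where "eig (-1) a b \<subseteq> span {v}" using eig_line assms by blast
  then have "x \<in> span {v}" "u \<in> span {v}" using assms by auto
  then obtain k l where kl: "x = k *s v" "u = l *s v"
    unfolding span_singleton by blast
  then have "l \<noteq> 0" using assms by auto
  then have "x = (k / l) *s u" using kl by simp
  then show ?thesis using that by blast
qed

text \<open>The commuting involutions \<open>(a b)\<close> and \<open>(c d)\<close> preserve each other's eigenlines, so \<open>(c d)\<close>
  multiplies a root of \<open>(a b)\<close> by \<open>1\<close> or \<open>-1\<close>. In the second case both reflections have the same
  root, and two commuting reflections with the same root are equal.\<close>
lemma disjoint_fixes_eig:
  assumes dist: "distinct [a, b, c, d]" and mem: "{a, b, c, d} \<subseteq> S" and u: "u \<in> eig (-1) a b"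
  shows "T c d u = u"
proof (cases "u = 0")
  case True
  then show ?thesis using assms T_zero by simp
next
  case False
  have ab: "a \<in> S" "b \<in> S" "a \<noteq> b" and cd: "c \<in> S" "d \<in> S" "c \<noteq> d"
    using assms by auto
  have uW: "u \<in> W" using u eig_subset by blast
  have "T c d u \<in> eig (-1) a b" using eig_invariant[of c d a b u "-1"] assms by auto
  then obtain k where k: "T c d u = k *s u" using eig_subset_span[OF ab u False] by blast
  have "u = (k * k) *s u"
    using T_invol[OF cd uW] k T_scale[OF cd] by simp
  then have "k * k = 1" using False by (metis scale_cancel_right scale_one)
  then have "k = 1 \<or> k = -1" by (metis power2_eq_1_iff power2_eq_square)
  moreover have "k \<noteq> -1"
  proof
    assume "k = -1"
    then have ucd: "u \<in> eig (-1) c d" using k uW by (simp add: eig_def)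
    have "T a b x = T c d x" if x: "x \<in> W" for x
    proof -
      obtain r where "T a b x - x = r *s u"
        using eig_subset_span[OF ab u False eig_minus_one_diff[OF ab x]] by blast
      then have r: "T a b x = x + r *s u" by (simp add: algebra_simps)
      obtain s where "T c d x - x = s *s u"
        using eig_subset_span[OF cd ucd False eig_minus_one_diff[OF cd x]] by blast
      then have s: "T c d x = x + s *s u" by (simp add: algebra_simps)
      have "T a b (T c d x) = T c d (T a b x)"
        using T_swap[OF ab cd x] dist by auto
      then have "r *s u - s *s u = s *s u - r *s u"
        using u ucd r s by (simp add: eig_def T_add[OF ab] T_add[OF cd] T_scale[OF ab] T_scale[OF cd])
      then have "(r - s) *s u + (r - s) *s u = 0"
        by (simp add: algebra_simps)
      then have "(r - s) *s u = 0" by (simp only: add_self_eq_0)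
      then show ?thesis using False r s by simp
    qed
    then show False using separated[OF dist mem] by (auto simp: separates_def)
  qed
  ultimately show ?thesis using k by simp
qed

lemma eig_nonzero:
  assumes "4 \<le> card S" and ab: "a \<in> S" "b \<in> S" "a \<noteq> b"
  obtains v where "v \<in> eig (-1) a b" "v \<noteq> 0"
proof -
  obtain c where c: "c \<in> S" "c \<notin> set [a, b]"
    by (rule ex_outside[of "[a, b]" S]) (use assms in auto)
  obtain d where d: "d \<in> S" "d \<notin> set [a, b, c]"
    by (rule ex_outside[of "[a, b, c]" S]) (use assms in auto)
  have quad: "distinct [a, b, c, d]" "{a, b, c, d} \<subseteq> S"
    using ab c d by auto
  show ?thesis
    by (rule separates_imp_eig_nonzero[OF separated[OF quad] quad ab]) (rule that)
qed

text \<open>Starting from one root \<open>v\<close> of \<open>(o' a)\<close>, transport it by \<open>(a b)\<close> to a root of \<open>(o' b)\<close>. The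
  permutation rule holds because \<open>v\<close> is fixed by the transpositions disjoint from \<open>(o' a)\<close>.\<close>
lemma permuted_eigenvectors:
  assumes "4 \<le> card S" and o: "o' \<in> S"
  obtains w where "\<And>b. b \<in> S - {o'} \<Longrightarrow> w b \<in> eig (-1) o' b"
    and "\<And>b. b \<in> S - {o'} \<Longrightarrow> w b \<noteq> 0"
    and "\<And>b c. \<lbrakk>b \<in> S - {o'}; c \<in> S - {o'}; b \<noteq> c\<rbrakk> \<Longrightarrow> T b c (w b) = w c"
proof -
  obtain a where a: "a \<in> S" "a \<notin> set [o']"
    by (rule ex_outside[of "[o']" S]) (use assms in auto)
  obtain v where v: "v \<in> eig (-1) o' a" "v \<noteq> 0"
    using eig_nonzero[of o' a] assms a by auto
  have vW: "v \<in> W" using v eig_subset by blast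
  let ?w = "\<lambda>b. if b = a then v else T a b v"
  show ?thesis
  proof (rule that[of ?w])
    fix b assume b: "b \<in> S - {o'}"
    show "?w b \<in> eig (-1) o' b"
      using eig_transport[of a b o' a v "-1"] a b o v by auto
    show "?w b \<noteq> 0"
      using T_invol[of a b v] T_zero[of a b] a b v vW by auto
    fix c assume c: "c \<in> S - {o'}" "b \<noteq> c"
    consider "b = a" | "c = a" | "b \<noteq> a" "c \<noteq> a" by blast
    then show "T b c (?w b) = ?w c"
    proof cases
      case 1
      then show ?thesis using c by simp
    next
      case 2
      then show ?thesis
        using T_commute[of b a "T a b v"] T_closed[of a b v] T_invol[of a b v] a b c vW by simp
    next
      case 3
      have "T b c (T a b v) = T a c (T b c v)"
        using T_swap[of b c a b v] 3 a b c vW by auto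
      moreover have "T b c v = v"
        using disjoint_fixes_eig[of o' a b c v] 3 a b c o v by auto
      ultimately show ?thesis using 3 by simp
    qed
  qed
qed

text \<open>Reflections move a vector along their root, so \<open>(o' a) w\<^sub>b = w\<^sub>b + m w\<^sub>a\<close> and
  \<open>(o' b) w\<^sub>a = w\<^sub>a + m' w\<^sub>b\<close> for some scalars. Comparing the two sides of
  \<open>(o' b) (o' a) (o' b) = (a b)\<close> at \<open>w\<^sub>b\<close> gives a linear relation between \<open>w\<^sub>a\<close> and
  \<open>w\<^sub>b\<close>; these are not collinear, whence \<open>m = -1\<close>.\<close>
lemma root_reflection:
  assumes "4 \<le> card S" and o: "o' \<in> S"
    and eig: "\<And>b. b \<in> S - {o'} \<Longrightarrow> w b \<in> eig (-1) o' b"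
    and nz: "\<And>b. b \<in> S - {o'} \<Longrightarrow> w b \<noteq> 0"
    and perm: "\<And>b c. \<lbrakk>b \<in> S - {o'}; c \<in> S - {o'}; b \<noteq> c\<rbrakk> \<Longrightarrow> T b c (w b) = w c"
    and ab: "a \<in> S - {o'}" "b \<in> S - {o'}" "a \<noteq> b"
  shows "T o' a (w b) = w b - w a"
proof -
  have oa: "o' \<in> S" "a \<in> S" "o' \<noteq> a" and ob: "o' \<in> S" "b \<in> S" "o' \<noteq> b"
    using o ab by auto
  have W: "w a \<in> W" "w b \<in> W" using eig eig_subset ab by blast+
  have neg: "T o' a (w a) = - w a" "T o' b (w b) = - w b"
    using eig ab by (auto simp: eig_def)
  have not_collinear: "w a \<noteq> k *s w b" for k
  proof
    assume k: "w a = k *s w b"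
    \<comment> \<open>A third letter turns collinearity into equality, which contradicts the braid relation.\<close>
    obtain c where c: "c \<in> S" "c \<notin> set [o', a, b]"
      by (rule ex_outside[of "[o', a, b]" S]) (use assms(1) in auto)
    have "T b c (w a) = w a"
      using disjoint_fixes_eig[of o' a b c "w a"] eig[of a] ab c o by auto
    have "T a b (w c) = w c"
      using disjoint_fixes_eig[of o' c a b "w c"] eig[of c] ab c o by auto
    have "T b c (w b) = w c"
      using perm[of b c] ab c by auto
    have "T a b (w b) = w a"
      using perm[of b a] T_commute[of a b "w b"] ab W by auto
    have "k \<noteq> 0" using k nz[of a] ab by auto
    have "k *s w b = k *s w c"
      using k \<open>T b c (w a) = w a\<close> \<open>T b c (w b) = w c\<close> T_scale[of b c k "w b"] ab c by auto
    then have "w b = w c" using \<open>k \<noteq> 0\<close> by simp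
    then have "w a = w b"
      using \<open>T a b (w c) = w c\<close> \<open>T a b (w b) = w a\<close> by simp
    have "T o' a (T o' b (T o' a (w a))) = T a b (w a)"
      using T_conj[OF oa ob W(1)] ab by auto
    then have "- w a = w a"
      using neg \<open>w a = w b\<close> T_neg[OF oa] T_neg[OF ob] perm[OF ab] by simp
    then have "w a + w a = 0" by (metis add.left_inverse)
    then show False using nz[of a] ab by (simp add: add_self_eq_0)
  qed
  obtain m where "T o' a (w b) - w b = m *s w a"
    using eig_subset_span[OF oa eig nz eig_minus_one_diff[OF oa W(2)]] ab by blast
  then have m: "T o' a (w b) = w b + m *s w a" by (simp add: algebra_simps)
  obtain m' where "T o' b (w a) - w a = m' *s w b"
    using eig_subset_span[OF ob eig nz eig_minus_one_diff[OF ob W(1)]] ab by blast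
  then have m': "T o' b (w a) = w a + m' *s w b" by (simp add: algebra_simps)
  have "w a = T o' b (T o' a (T o' b (w b)))"
    using T_conj[OF ob oa W(2)] perm[of b a] ab by auto
  also have "\<dots> = w b - m *s (w a + m' *s w b)"
    by (simp add: neg m m' T_neg[OF oa] T_neg[OF ob] T_add[OF ob] T_scale[OF ob] T_diff[OF ob]
        algebra_simps)
  finally have "(1 + m) *s w a = (1 - m * m') *s w b"
    by (simp add: algebra_simps)
  then have "1 + m = 0"
    using not_collinear[of "(1 - m * m') / (1 + m)"]
    by (metis scale_left_imp_eq scale_scale nonzero_mult_div_cancel_left times_divide_eq_right)
  then have "m = -1" by (simp add: eq_neg_iff_add_eq_0 add.commute)
  then show ?thesis using m by simp
qed

text \<open>Applying \<open>(o' a)\<close> to a linear relation with coefficients \<open>g\<^sub>b\<close> and sum of coefficients \<open>C\<close> subtracts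
  \<open>(C + g\<^sub>a) w\<^sub>a\<close> from it, the coefficient of \<open>w\<^sub>a\<close> itself being counted twice. Thus every
  coefficient equals \<open>-C\<close>, and summing them up gives \<open>card S * C = 0\<close>; here characteristic
  zero enters.\<close>
lemma independent_roots:
  assumes "4 \<le> card S"
  shows "\<exists>B\<subseteq>W. finite B \<and> independent B \<and> card B = card S - 1"
proof -
  have fin: "finite S" using assms by (metis card.infinite not_numeral_le_zero)
  obtain o' where o: "o' \<in> S" using assms by fastforce
  obtain w where eig: "\<And>b. b \<in> S - {o'} \<Longrightarrow> w b \<in> eig (-1) o' b"
    and nz: "\<And>b. b \<in> S - {o'} \<Longrightarrow> w b \<noteq> 0"
    and perm: "\<And>b c. \<lbrakk>b \<in> S - {o'}; c \<in> S - {o'}; b \<noteq> c\<rbrakk> \<Longrightarrow> T b c (w b) = w c"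
    using permuted_eigenvectors[OF assms o] by metis
  let ?R = "S - {o'}"
  have reflect: "T o' a (w b) = w b - w a" if "a \<in> ?R" "b \<in> ?R" "a \<noteq> b" for a b
    using root_reflection[OF assms o, of w a b] eig nz perm that by blast
  have neg: "T o' a (w a) = - w a" if "a \<in> ?R" for a
    using eig[OF that] by (simp add: eig_def)
  have inj: "inj_on w ?R"
  proof (rule inj_onI, rule ccontr)
    fix a b assume ab: "a \<in> ?R" "b \<in> ?R" "w a = w b" "a \<noteq> b"
    then have "T o' a (w b) = 0" using reflect[OF ab(1,2,4)] by simp
    then show False using neg[OF ab(1)] nz ab by simp
  qed
  have "independent (w ` ?R)"
  proof (rule independent_if_scalars_zero)
    show "finite (w ` ?R)" using fin by simp
    fix f x assume "(\<Sum>x\<in>w ` ?R. f x *s x) = 0" and x: "x \<in> w ` ?R"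
    then have rel: "(\<Sum>b\<in>?R. f (w b) *s w b) = 0"
      by (simp add: sum.reindex[OF inj] o_def)
    define C where "C = (\<Sum>b\<in>?R. f (w b))"
    have coeff: "f (w a) = - C" if a: "a \<in> ?R" for a
    proof -
      have oa: "o' \<in> S" "a \<in> S" "o' \<noteq> a" using o a by auto
      have step: "T o' a (w b) = w b - (1 + of_bool (b = a)) *s w a" if "b \<in> ?R" for b
        using reflect[OF a that] neg[OF a] by (auto simp: algebra_simps two_scale[symmetric])
      have "0 = T o' a (\<Sum>b\<in>?R. f (w b) *s w b)"
        using rel T_zero[OF oa] by simp
      also have "\<dots> = (\<Sum>b\<in>?R. f (w b) *s w b - (f (w b) * (1 + of_bool (b = a))) *s w a)"
        unfolding T_sum[OF oa]
        by (intro sum.cong refl) (simp only: T_scale[OF oa] step scale_right_diff_distrib scale_scale)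
      also have "\<dots> = - ((C + f (w a)) *s w a)"
      proof -
        have "(\<Sum>b\<in>?R. f (w b) * (1 + of_bool (b = a))) = C + f (w a)"
          using a fin by (simp add: C_def ring_distribs sum.distrib)
        then show ?thesis by (simp add: sum_subtractf rel flip: scale_sum_left)
      qed
      finally have "(C + f (w a)) *s w a = 0" by simp
      then have "C + f (w a) = 0" using nz[OF a] scale_eq_0_iff by blast
      then show ?thesis by (simp add: eq_neg_iff_add_eq_0 add.commute)
    qed
    have "(\<Sum>b\<in>?R. f (w b)) = (\<Sum>b\<in>?R. - C)"
      by (intro sum.cong refl coeff)
    then have "C = - of_nat (card S - 1) * C"
      using o fin by (simp only: C_def[symmetric] sum_constant) simp
    then have "of_nat (Suc (card S - 1)) * C = 0"
      by (simp only: of_nat_Suc distrib_right mult_1) (metis add.right_inverse mult_minus_left add.commute)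
    then have "C = 0"
      by (metis mult_eq_0_iff of_nat_eq_0_iff nat.distinct(1))
    then show "f x = 0" using coeff x by auto
  qed
  moreover have "w ` ?R \<subseteq> W" using eig eig_subset by blast
  moreover have "card (w ` ?R) = card S - 1"
    using o fin by (simp add: card_image[OF inj])
  ultimately show ?thesis using fin by blast
qed

end

section \<open>The lower bound for the dimension\<close>

lemma (in transposition_action) reflection_independent:
  assumes "4 \<le> card S" "separates a b c d" "distinct [a, b, c, d]" "{a, b, c, d} \<subseteq> S"
    and pq: "p \<in> S" "q \<in> S" "p \<noteq> q"
    and line: "v \<in> eig (-1) p q" "eig (-1) p q \<subseteq> span {v}"
  shows "\<exists>B\<subseteq>W. finite B \<and> independent B \<and> card B = card S - 1"
proof -
  have "reflection_action scale S W T"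
  proof (intro reflection_action.intro reflection_action_axioms.intro)
    show "transposition_action scale S W T" by (rule transposition_action_axioms)
    show "separates a' b' c' d'" if "distinct [a', b', c', d']" "{a', b', c', d'} \<subseteq> S" for a' b' c' d'
      using separates_all[OF assms(3,4,2) that] .
    show "\<exists>v\<in>eig (-1) a b. eig (-1) a b \<subseteq> span {v}" if "a \<in> S" "b \<in> S" "a \<noteq> b" for a b
      by (rule eig_line_all[OF pq line that]) blast
  qed
  then show ?thesis using assms(1) by (rule reflection_action.independent_roots)
qed

text \<open>Induction on the number of letters, removing two of them at a time. The eigenspaces of one
  transposition \<open>(p q)\<close> decide the case: a small eigenspace leads to reflections; two big ones
  provide independent vectors, by induction from at least six letters on.\<close>
lemma separated_imp_independent:
  fixes scale :: "'k::field_char_0 \<Rightarrow> 'v::ab_group_add \<Rightarrow> 'v"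
  assumes "transposition_action scale S W T" "4 \<le> card S"
    and "distinct [a, b, c, d]" "{a, b, c, d} \<subseteq> S" "x \<in> W" "T a b x \<noteq> T c d x"
  shows "\<exists>B\<subseteq>W. finite B \<and> \<not> module.dependent scale B \<and> card S - 1 \<le> card B"
  using assms
proof (induction "card S" arbitrary: S W x rule: less_induct)
  case less
  interpret A: transposition_action scale S W T by fact
  have sep: "A.separates a b c d" using less.prems by (auto simp: A.separates_def)
  \<comment> \<open>For the induction the quadruple must survive the removal of \<open>p\<close> and \<open>q\<close>, which requires six letters.\<close>
  obtain p q where pq: "p \<in> S" "q \<in> S" "p \<noteq> q"
    and outside: "6 \<le> card S \<Longrightarrow> {p, q} \<inter> {a, b, c, d} = {}"
  proof (cases "6 \<le> card S")
    case True
    obtain p where "p \<in> S" "p \<notin> set [a, b, c, d]"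
      by (rule ex_outside[of "[a, b, c, d]" S]) (use True in auto)
    moreover obtain q where "q \<in> S" "q \<notin> set [a, b, c, d, p]"
      by (rule ex_outside[of "[a, b, c, d, p]" S]) (use True in auto)
    ultimately show ?thesis using that[of p q] by auto
  next
    case False
    then show ?thesis using that[of a b] less.prems by simp
  qed
  note sub = A.subspace_eig[OF pq]
  consider (neg) "\<exists>v\<in>A.eig (-1) p q. A.eig (-1) p q \<subseteq> A.span {v}"
    | (pos) "\<exists>v\<in>A.eig 1 p q. A.eig 1 p q \<subseteq> A.span {v}"
    | (both) "\<exists>B\<subseteq>A.eig 1 p q. finite B \<and> A.independent B \<and> card B = 2"
        "\<exists>B\<subseteq>A.eig (-1) p q. finite B \<and> A.independent B \<and> card B = 2"
    using A.line_or_independent_pair[OF sub[of 1]] A.line_or_independent_pair[OF sub[of "-1"]]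
    by argo
  then show ?case
  proof cases
    case neg
    then obtain v where v: "v \<in> A.eig (-1) p q" "A.eig (-1) p q \<subseteq> A.span {v}" by blast
    obtain B where "B \<subseteq> W" "finite B" "A.independent B" "card B = card S - 1"
      using A.reflection_independent[OF less.prems(2) sep less.prems(3,4) pq v] by blast
    then show ?thesis by (intro exI[of _ B]) simp
  next
    case pos
    then obtain v where v: "v \<in> A.eig 1 p q" "A.eig 1 p q \<subseteq> A.span {v}" by blast
    interpret M: transposition_action scale S W "\<lambda>a b x. - T a b x"
      by (rule A.transposition_action_sign_twist)
    have eq: "M.eig (-1) p q = A.eig 1 p q" and "M.separates a b c d"
      using sep by (auto simp: M.eig_def A.eig_def M.separates_def A.separates_def)
    then obtain B where "B \<subseteq> W" "finite B" "A.independent B" "card B = card S - 1"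
      using M.reflection_independent[OF less.prems(2) _ less.prems(3,4) pq, of v] v unfolding eq by blast
    then show ?thesis by (intro exI[of _ B]) simp
  next
    case both
    then obtain P N where PN: "P \<subseteq> A.eig 1 p q" "finite P" "A.independent P" "card P = 2"
      "N \<subseteq> A.eig (-1) p q" "finite N" "A.independent N" "card N = 2"
      by (elim exE conjE)
    have union: "\<exists>B\<subseteq>W. finite B \<and> A.independent B \<and> card S - 1 \<le> card B"
      if "P' \<subseteq> A.eig 1 p q" "finite P'" "A.independent P'"
        "N' \<subseteq> A.eig (-1) p q" "finite N'" "A.independent N'" "card S - 1 \<le> card P' + card N'" for P' N'
    proof -
      have "A.independent (P' \<union> N') \<and> P' \<inter> N' = {}"
        using A.independent_Un_if_trivial_Int[OF sub sub A.eig_Int] that by blast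
      moreover have "P' \<union> N' \<subseteq> W"
        using that(1,4) A.eig_subset[of 1 p q] A.eig_subset[of "-1" p q] by blast
      ultimately show ?thesis
        using that card_Un_disjoint[of P' N'] by (intro exI[of _ "P' \<union> N'"]) simp
    qed
    show ?thesis
    proof (cases "6 \<le> card S")
      case False
      then show ?thesis using union[of P N] PN by simp
    next
      case True
      have fin: "finite S" using True by (metis card.infinite not_numeral_le_zero)
      have card: "card (S - {p, q}) = card S - 2"
        using pq fin by (simp add: card_Diff_subset)
      have quad: "{a, b, c, d} \<subseteq> S - {p, q}" using outside[OF True] less.prems by auto
      have IH: "\<exists>B\<subseteq>A.eig r p q. finite B \<and> A.independent B \<and> card S - 3 \<le> card B"
        if "y \<in> A.eig r p q" "T a b y \<noteq> T c d y" for r y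
      proof -
        have "transposition_action scale (S - {p, q}) (A.eig r p q) T"
        proof (rule A.transposition_action_Int)
          show "T e f x \<in> A.eig r p q"
            if "e \<in> S - {p, q}" "f \<in> S - {p, q}" "e \<noteq> f" "x \<in> A.eig r p q" for e f x
            using A.eig_invariant[of e f p q x r] that pq by auto
        qed (use sub A.eig_subset in auto)
        then show ?thesis
          using less.hyps[of "S - {p, q}" "A.eig r p q" y] that less.prems(3) quad True card by simp
      qed
      obtain y z where yz: "y \<in> A.eig 1 p q" "z \<in> A.eig (-1) p q" "x = y + z"
        using A.eig_decompose[OF pq \<open>x \<in> W\<close>] by blast
      have "T a b y \<noteq> T c d y \<or> T a b z \<noteq> T c d z"
        using less.prems yz A.T_add[of a b y z] A.T_add[of c d y z] by auto
      then show ?thesis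
      proof
        assume "T a b y \<noteq> T c d y"
        then obtain P' where "P' \<subseteq> A.eig 1 p q" "finite P'" "A.independent P'" "card S - 3 \<le> card P'"
          using IH yz by blast
        then show ?thesis using union[of P' N] PN by simp
      next
        assume "T a b z \<noteq> T c d z"
        then obtain N' where "N' \<subseteq> A.eig (-1) p q" "finite N'" "A.independent N'" "card S - 3 \<le> card N'"
          using IH yz by blast
        then show ?thesis using union[of P N'] PN by simp
      qed
    qed
  qed
qed

section \<open>Complex matrices as linear operators\<close>

text \<open>Complex coordinate space is modelled inside the functions on the natural numbers, because the
  theory of vector spaces requires the addition of a type. Vectors of length \<open>d\<close> are the functions
  that vanish from \<open>d\<close> on.\<close>
definition coord_scale :: "complex \<Rightarrow> (nat \<Rightarrow> complex) \<Rightarrow> nat \<Rightarrow> complex"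
  where "coord_scale c f = (\<lambda>i. c * f i)"

definition coord_space :: "nat \<Rightarrow> (nat \<Rightarrow> complex) set"
  where "coord_space d = {f. \<forall>i\<ge>d. f i = 0}"

definition mat_op :: "nat \<Rightarrow> complex mat \<Rightarrow> (nat \<Rightarrow> complex) \<Rightarrow> nat \<Rightarrow> complex"
  where "mat_op d A f = (\<lambda>i. if i < d then \<Sum>j<d. A $$ (i, j) * f j else 0)"

interpretation coord: vector_space coord_scale
  by unfold_locales (auto simp: coord_scale_def fun_eq_iff algebra_simps)

lemma mat_op_module_hom: "module_hom coord_scale coord_scale (mat_op d A)"
  by unfold_locales
    (auto simp: coord_scale_def mat_op_def fun_eq_iff algebra_simps sum.distrib sum_distrib_left)

lemma mat_op_in_coord_space: "mat_op d A f \<in> coord_space d"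
  by (simp add: mat_op_def coord_space_def)

lemma subspace_coord_space: "coord.subspace (coord_space d)"
  by (auto simp: coord.subspace_def coord_space_def coord_scale_def)

lemma mat_op_mult:
  assumes "A \<in> carrier_mat d d" "B \<in> carrier_mat d d"
  shows "mat_op d A (mat_op d B f) = mat_op d (A * B) f"
proof
  fix i
  show "mat_op d A (mat_op d B f) i = mat_op d (A * B) f i"
  proof (cases "i < d")
    case True
    have "mat_op d A (mat_op d B f) i = (\<Sum>j<d. \<Sum>k<d. A $$ (i, j) * B $$ (j, k) * f k)"
      using True by (simp add: mat_op_def sum_distrib_left mult.assoc)
    also have "\<dots> = (\<Sum>k<d. \<Sum>j<d. A $$ (i, j) * B $$ (j, k) * f k)"
      by (rule sum.swap)
    also have "\<dots> = mat_op d (A * B) f i"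
      using True assms by (simp add: mat_op_def scalar_prod_def sum_distrib_right atLeast0LessThan)
    finally show ?thesis .
  qed (simp add: mat_op_def)
qed

lemma mat_op_one: "f \<in> coord_space d \<Longrightarrow> mat_op d (1\<^sub>m d) f = f"
  by (auto simp: mat_op_def coord_space_def fun_eq_iff if_distrib[of "\<lambda>x. x * _"] cong: if_cong)

lemma mat_op_inject:
  assumes "A \<in> carrier_mat d d" "B \<in> carrier_mat d d"
    and "\<And>f. f \<in> coord_space d \<Longrightarrow> mat_op d A f = mat_op d B f"
  shows "A = B"
proof (rule eq_matI)
  fix i j assume ij: "i < dim_row B" "j < dim_col B"
  let ?e = "\<lambda>k. of_bool (k = j) :: complex"
  have "mat_op d A ?e i = mat_op d B ?e i"
    using assms(2) assms(3)[of ?e] ij by (auto simp: coord_space_def)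
  then show "A $$ (i, j) = B $$ (i, j)"
    using ij assms(1,2) by (simp add: mat_op_def)
qed (use assms in auto)

lemma card_independent_coord_space:
  assumes "B \<subseteq> coord_space d" "coord.independent B"
  shows "card B \<le> d"
proof -
  let ?e = "\<lambda>j k. of_bool (k = j) :: complex"
  have "f \<in> coord.span (?e ` {..<d})" if f: "f \<in> coord_space d" for f
  proof -
    have "(\<Sum>j<d. coord_scale (f j) (?e j)) k = (\<Sum>j<d. coord_scale (f j) (?e j) k)" for k
      by (induction d) auto
    moreover have "{..<d} \<inter> {k} = (if k < d then {k} else {})" for k by auto
    ultimately have "f = (\<Sum>j<d. coord_scale (f j) (?e j))"
      using f by (auto simp: fun_eq_iff coord_scale_def coord_space_def)
    also have "\<dots> \<in> coord.span (?e ` {..<d})"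
      by (intro coord.span_sum coord.span_scale coord.span_base) auto
    finally show ?thesis .
  qed
  then have "card B \<le> card (?e ` {..<d})"
    using coord.independent_span_bound[of "?e ` {..<d}" B] assms by auto
  also have "\<dots> \<le> d" using card_image_le[of "{..<d}" ?e] by simp
  finally show ?thesis .
qed

section \<open>The images of transpositions\<close>

lemma transpose_conjugate:
  "Transposition.transpose a b \<circ> Transposition.transpose c d \<circ> Transposition.transpose a b
    = Transposition.transpose (Transposition.transpose a b c) (Transposition.transpose a b d)"
  by (simp add: transpose_comp_eq[of "Transposition.transpose a b"] comp_assoc)
    (simp flip: comp_assoc)

lemma transpose_in_sym_group:
  "\<lbrakk>a \<in> {1..n}; b \<in> {1..n}\<rbrakk> \<Longrightarrow> Transposition.transpose a b \<in> carrier (sym_group n)"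
  by (simp add: sym_group_carrier permutes_swap_id)

lemma hom_GL_carrier:
  "\<lbrakk>\<rho> \<in> hom (sym_group n) (GL d); p \<in> carrier (sym_group n)\<rbrakk> \<Longrightarrow> \<rho> p \<in> carrier_mat d d"
  by (auto simp: hom_def carrier_GL)

lemma hom_GL_comp:
  "\<lbrakk>\<rho> \<in> hom (sym_group n) (GL d); p \<in> carrier (sym_group n); q \<in> carrier (sym_group n)\<rbrakk>
    \<Longrightarrow> \<rho> (p \<circ> q) = \<rho> p * \<rho> q"
  using hom_mult[of \<rho> "sym_group n" "GL d" p q] by (simp add: sym_group_mult mult_GL)

lemma hom_GL_id:
  assumes "\<rho> \<in> hom (sym_group n) (GL d)"
  shows "\<rho> id = 1\<^sub>m d"
proof -
  interpret group_hom "sym_group n" "GL d" \<rho>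
    using assms by (simp add: group_hom_def group_hom_axioms_def sym_group_is_group GL_is_group)
  show ?thesis
    using hom_one by (simp add: sym_group_one GL_def units_of_def ring_mat_simps)
qed

lemma transposition_action_of_hom:
  assumes \<rho>: "\<rho> \<in> hom (sym_group n) (GL d)"
  shows "transposition_action coord_scale {1..n} (coord_space d)
    (\<lambda>a b. mat_op d (\<rho> (Transposition.transpose a b)))"
proof (intro transposition_action.intro transposition_action_axioms.intro)
  let ?t = "Transposition.transpose"
  note [simp] = transpose_in_sym_group hom_GL_carrier[OF \<rho>]
  have mult: "mat_op d (\<rho> p) (mat_op d (\<rho> q) f) = mat_op d (\<rho> (p \<circ> q)) f"
    if "p \<in> carrier (sym_group n)" "q \<in> carrier (sym_group n)" for p q f
    using that by (simp add: mat_op_mult hom_GL_comp[OF \<rho>])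
  fix a b assume ab: "a \<in> {1..n}" "b \<in> {1..n}"
  fix x assume x: "x \<in> coord_space d"
  show "mat_op d (\<rho> (?t a b)) (mat_op d (\<rho> (?t a b)) x) = x"
    using ab x by (simp only: mult transpose_in_sym_group transpose_comp_involutory hom_GL_id[OF \<rho>] mat_op_one)
  fix c e assume ce: "c \<in> {1..n}" "e \<in> {1..n}"
  have comp: "?t a b \<circ> ?t c e \<in> carrier (sym_group n)"
    using ab ce by (simp add: sym_group_carrier permutes_compose permutes_swap_id)
  have "mat_op d (\<rho> (?t a b)) (mat_op d (\<rho> (?t c e)) (mat_op d (\<rho> (?t a b)) x))
    = mat_op d (\<rho> (?t a b \<circ> ?t c e)) (mat_op d (\<rho> (?t a b)) x)"
    using ab ce by (intro mult transpose_in_sym_group)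
  also have "\<dots> = mat_op d (\<rho> (?t a b \<circ> ?t c e \<circ> ?t a b)) x"
    using ab comp by (intro mult transpose_in_sym_group)
  finally show "mat_op d (\<rho> (?t a b)) (mat_op d (\<rho> (?t c e)) (mat_op d (\<rho> (?t a b)) x))
    = mat_op d (\<rho> (?t (?t a b c) (?t a b e))) x"
    by (simp only: transpose_conjugate)
qed (simp_all add: mat_op_module_hom mat_op_in_coord_space subspace_coord_space coord.vector_space_axioms)

text \<open>Otherwise the lower bound would produce \<open>n - 1\<close> independent vectors in a space of
  dimension \<open>d < n - 1\<close>.\<close>
lemma hom_GL_disjoint_transpositions:
  assumes n: "5 \<le> n" and d: "d < n - 1" and \<rho>: "\<rho> \<in> hom (sym_group n) (GL d)"
    and quad: "distinct [a, b, c, e]" "{a, b, c, e} \<subseteq> {1..n}"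
  shows "\<rho> (Transposition.transpose a b) = \<rho> (Transposition.transpose c e)"
proof (rule mat_op_inject)
  show "\<rho> (Transposition.transpose a b) \<in> carrier_mat d d" "\<rho> (Transposition.transpose c e) \<in> carrier_mat d d"
    using quad by (auto intro!: hom_GL_carrier[OF \<rho>] transpose_in_sym_group)
  fix f assume f: "f \<in> coord_space d"
  show "mat_op d (\<rho> (Transposition.transpose a b)) f = mat_op d (\<rho> (Transposition.transpose c e)) f"
  proof (rule ccontr)
    assume "\<not> ?thesis"
    then have sep: "mat_op d (\<rho> (Transposition.transpose a b)) f \<noteq> mat_op d (\<rho> (Transposition.transpose c e)) f" .
    have four: "4 \<le> card {1..n}" using n by simp
    have "\<exists>B\<subseteq>coord_space d. finite B \<and> coord.independent B \<and> card {1..n} - 1 \<le> card B"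
      by (rule separated_imp_independent[OF transposition_action_of_hom[OF \<rho>] four quad f]) (rule sep)
    then obtain B where B: "B \<subseteq> coord_space d" "coord.independent B" "card {1..n} - 1 \<le> card B"
      by blast
    show False using card_independent_coord_space[OF B(1,2)] B(3) d by simp
  qed
qed

text \<open>Two different transpositions with a common letter use three letters, so five letters leave room for
  a third transposition disjoint from both.\<close>
lemma hom_GL_transpositions_equal:
  assumes n: "5 \<le> n" and d: "d < n - 1" and \<rho>: "\<rho> \<in> hom (sym_group n) (GL d)"
    and ab: "a \<in> {1..n}" "b \<in> {1..n}" "a \<noteq> b" and pq: "p \<in> {1..n}" "q \<in> {1..n}" "p \<noteq> q"
  shows "\<rho> (Transposition.transpose a b) = \<rho> (Transposition.transpose p q)"
proof (cases "{a, b} \<inter> {p, q} = {}")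
  case True
  then show ?thesis
    by (intro hom_GL_disjoint_transpositions[OF n d \<rho>]) (use ab pq in auto)
next
  case False
  then obtain r where r: "{a, b, p, q} \<subseteq> set [a, b, r]" by auto
  obtain c where c: "c \<in> {1..n}" "c \<notin> set [a, b, r]"
    by (rule ex_outside[of "[a, b, r]" "{1..n}"]) (use n in auto)
  obtain e where e: "e \<in> {1..n}" "e \<notin> set [a, b, r, c]"
    by (rule ex_outside[of "[a, b, r, c]" "{1..n}"]) (use n in auto)
  have "\<rho> (Transposition.transpose a b) = \<rho> (Transposition.transpose c e)"
    by (intro hom_GL_disjoint_transpositions[OF n d \<rho>]) (use ab c e in auto)
  also have "\<dots> = \<rho> (Transposition.transpose p q)"
    by (intro hom_GL_disjoint_transpositions[OF n d \<rho>]) (use pq r c e in auto)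
  finally show ?thesis .
qed

lemma hom_GL_image_two_elements:
  assumes n: "5 \<le> n" and d: "d < n - 1" and \<rho>: "\<rho> \<in> hom (sym_group n) (GL d)"
    and p: "p permutes {1..n}"
  shows "\<rho> p \<in> {1\<^sub>m d, \<rho> (Transposition.transpose 1 2)}"
proof -
  let ?M = "\<rho> (Transposition.transpose 1 2)"
  have M: "Transposition.transpose 1 2 \<in> carrier (sym_group n)"
    using n by (intro transpose_in_sym_group) auto
  have "?M * ?M = 1\<^sub>m d"
    using hom_GL_comp[OF \<rho> M M] hom_GL_id[OF \<rho>] by simp
  show ?thesis
    using p finite_atLeastAtMost
  proof (induction rule: permutes_induct)
    case id
    then show ?case using hom_GL_id[OF \<rho>] by (simp add: id_def)
  next
    case (swap a b p)
    have "\<rho> (Transposition.transpose a b \<circ> p) = \<rho> (Transposition.transpose a b) * \<rho> p"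
      by (rule hom_GL_comp[OF \<rho>]) (use swap in \<open>auto simp: sym_group_carrier permutes_swap_id\<close>)
    also have "\<rho> (Transposition.transpose a b) = ?M"
      using swap n by (intro hom_GL_transpositions_equal[OF n d \<rho>]) auto
    finally show ?case
      using swap.IH \<open>?M * ?M = 1\<^sub>m d\<close> hom_GL_carrier[OF \<rho> M] by auto
  qed
qed

lemma mat_commute_if_dim_le_one:
  fixes A B :: "'a::comm_semiring_0 mat"
  assumes "A \<in> carrier_mat d d" "B \<in> carrier_mat d d" "d \<le> 1"
  shows "A * B = B * A"
proof (rule eq_matI)
  fix i j assume "i < dim_row (B * A)" "j < dim_col (B * A)"
  then show "(A * B) $$ (i, j) = (B * A) $$ (i, j)"
    using assms by (cases "d = 0") (auto simp: scalar_prod_def mult.commute le_Suc_eq)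
qed (use assms in auto)

theorem proposition12p1:
  fixes n d :: nat and \<rho> :: "(nat \<Rightarrow> nat) \<Rightarrow> complex mat"
  assumes "n > 0" and "n \<noteq> 4" and "d < n - 1"
    and "\<rho> \<in> hom (sym_group n) (GL d)"
  shows "comm_group ((GL d)\<lparr>carrier := \<rho> ` carrier (sym_group n)\<rparr>)"
proof -
  interpret group_hom "sym_group n" "GL d" \<rho>
    using assms by (simp add: group_hom_def group_hom_axioms_def sym_group_is_group GL_is_group)
  have commute: "\<rho> p * \<rho> q = \<rho> q * \<rho> p"
    if "p \<in> carrier (sym_group n)" "q \<in> carrier (sym_group n)" for p q
  proof (cases "n \<le> 3")
    case True
    then have "d \<le> 1" using assms(3) by simp
    then show ?thesis using mat_commute_if_dim_le_one hom_GL_carrier[OF assms(4)] that by blast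
  next
    case False
    then have "5 \<le> n" using assms(2) by simp
    note two = hom_GL_image_two_elements[OF this assms(3,4)]
    have "\<rho> p = 1\<^sub>m d \<or> \<rho> q = 1\<^sub>m d \<or> \<rho> p = \<rho> q"
      using two[of p] two[of q] that unfolding sym_group_carrier by auto
    moreover have "\<rho> p \<in> carrier_mat d d" "\<rho> q \<in> carrier_mat d d"
      using hom_GL_carrier[OF assms(4)] that by blast+
    ultimately show ?thesis by (elim disjE) simp_all
  qed
  show ?thesis
  proof (rule group.group_comm_groupI)
    show "group ((GL d)\<lparr>carrier := \<rho> ` carrier (sym_group n)\<rparr>)"
      by (rule subgroup.subgroup_is_group[OF img_is_subgroup H.is_group])
    fix x y assume "x \<in> carrier ((GL d)\<lparr>carrier := \<rho> ` carrier (sym_group n)\<rparr>)"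
      and "y \<in> carrier ((GL d)\<lparr>carrier := \<rho> ` carrier (sym_group n)\<rparr>)"
    then obtain p q where "p \<in> carrier (sym_group n)" "q \<in> carrier (sym_group n)" "x = \<rho> p" "y = \<rho> q"
      by auto
    then show "x \<otimes>\<^bsub>(GL d)\<lparr>carrier := \<rho> ` carrier (sym_group n)\<rparr>\<^esub> y
      = y \<otimes>\<^bsub>(GL d)\<lparr>carrier := \<rho> ` carrier (sym_group n)\<rparr>\<^esub> x"
      by (simp add: mult_GL commute)
  qed
qed

end
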